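(* The proof system ${\bf ECZ^\Delta}$ is strongly complete with respect to the class of all $(cz)$-frames, i.e. the class of all neighborhood frames possessing both properties $(c)$ and $(z)$.
   Context: Fix a nonempty set $\mathbf{P}$ of propositional variables. The language $\mathcal{L}(\Delta)$ is given by $\varphi::=p\in\mathbf{P}\mid\neg\varphi\mid\varphi\land\varphi\mid\Delta\varphi$; $\vee,\to,\leftrightarrow,\top$ are the usual abbreviations. A neighborhood frame is a pair $\langle S,N\rangle$ with $S$ a nonempty set and $N:S\to\mathcal{P}(\mathcal{P}(S))$; a neighborhood model $\mathcal{M}=\langle S,N,V\rangle$ adds a valuation $V$ assigning a set $V(p)\subseteq S$ to each $p\in\mathbf{P}$. Truth: $\mathcal{M},s\vDash p$ iff $s\in V(p)$; Boolean clauses as usual; $\mathcal{M},s\vDash\Delta\varphi$ iff $\varphi^{\mathcal{M}}\in N(s)$ or $S\setminus\varphi^{\mathcal{M}}\in N(s)$, where $\varphi^{\mathcal{M}}=\{s\in S\mid\mathcal{M},s\vDash\varphi\}$. Frame properties (required for every $s\in S$): $(c)$: $X,Y\in N(s)$ implies $X\cap Y\in N(s)$; $(z)$: $X\in N(s)$ implies $S\setminus X\in N(s)$. The system ${\bf ECZ^\Delta}$ has as axiom schemas all instances of propositional tautologies (TAUT), $\Delta\text{Equ}$: $\Delta\varphi\leftrightarrow\Delta\neg\varphi$, and $\Delta\text{C}$: $\Delta\varphi\land\Delta\psi\to\Delta(\varphi\land\psi)$; its rules are MP (from $\varphi$ and $\varphi\to\psi$ infer $\psi$) and $\text{RE}\Delta$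 (from $\varphi\leftrightarrow\psi$ infer $\Delta\varphi\leftrightarrow\Delta\psi$). A set $\Gamma$ of formulas is consistent in a system $\Lambda$ if there are no $\gamma_1,\dots,\gamma_n\in\Gamma$ such that $\neg(\gamma_1\land\dots\land\gamma_n)$ is a theorem of $\Lambda$. $\Lambda$ is strongly complete with respect to a class $\mathbb{K}$ of frames if every $\Lambda$-consistent set of formulas is satisfied (all members true) at some state of some model based on a frame in $\mathbb{K}$. *)

theory Defs
  imports Main
begin

datatype 'p fm =
    Atom 'p
  | Neg "'p fm"  ("\<sim> _" [70] 70)
  | Conj "'p fm" "'p fm"  (infixr "\<sqinter>" 65)
  | Dlt "'p fm"  ("\<Delta> _" [70] 70)

abbreviation Imp :: "'p fm \<Rightarrow> 'p fm \<Rightarrow> 'p fm"  (infixr "\<rightharpoonup>" 55)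
  where "\<phi> \<rightharpoonup> \<psi> \<equiv> \<sim> (\<phi> \<sqinter> \<sim> \<psi>)"

abbreviation Iff :: "'p fm \<Rightarrow> 'p fm \<Rightarrow> 'p fm"  (infix "\<rightleftharpoons>" 54)
  where "\<phi> \<rightleftharpoons> \<psi> \<equiv> (\<phi> \<rightharpoonup> \<psi>) \<sqinter> (\<psi> \<rightharpoonup> \<phi>)"

(* The set of variables of the language is the whole (nonempty) type 'p. *)

record 's nframe =
  states :: "'s set"
  nbhd :: "'s \<Rightarrow> 's set set"

record ('s, 'p) nmodel = "'s nframe" +
  val :: "'p \<Rightarrow> 's set"

(* The properties below mention only points of the carrier; nbhd is
   unconstrained outside it. *)

definition neighborhood_frame :: "'s nframe \<Rightarrow> bool" where
  "neighborhood_frame F \<longleftrightarrow>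
     states F \<noteq> {} \<and> (\<forall>s\<in>states F. nbhd F s \<subseteq> Pow (states F))"

definition frame_of :: "('s, 'p) nmodel \<Rightarrow> 's nframe" where
  "frame_of M = nframe.truncate M"

definition neighborhood_model :: "('s, 'p) nmodel \<Rightarrow> bool" where
  "neighborhood_model M \<longleftrightarrow>
     neighborhood_frame (frame_of M) \<and> (\<forall>p. val M p \<subseteq> states M)"

primrec sat :: "('s, 'p) nmodel \<Rightarrow> 's \<Rightarrow> 'p fm \<Rightarrow> bool" where
  "sat M s (Atom p) \<longleftrightarrow> s \<in> val M p"
| "sat M s (\<sim> \<phi>) \<longleftrightarrow> \<not> sat M s \<phi>"
| "sat M s (\<phi> \<sqinter> \<psi>) \<longleftrightarrow> sat M s \<phi> \<and> sat M s \<psi>"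
| "sat M s (\<Delta> \<phi>) \<longleftrightarrow>
     {t \<in> states M. sat M t \<phi>} \<in> nbhd M s \<or>
     states M - {t \<in> states M. sat M t \<phi>} \<in> nbhd M s"

definition property_c :: "'s nframe \<Rightarrow> bool" where
  "property_c F \<longleftrightarrow>
     (\<forall>s\<in>states F. \<forall>X Y. X \<in> nbhd F s \<and> Y \<in> nbhd F s \<longrightarrow> X \<inter> Y \<in> nbhd F s)"

definition property_z :: "'s nframe \<Rightarrow> bool" where
  "property_z F \<longleftrightarrow>
     (\<forall>s\<in>states F. \<forall>X. X \<in> nbhd F s \<longrightarrow> states F - X \<in> nbhd F s)"

definition cz_frames :: "'s nframe set" where
  "cz_frames = {F. neighborhood_frame F \<and> property_c F \<and> property_z F}"

(* Schemas for tautologies use their own countable supply of schematic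
   variables: 'p may be finite, and then substitution instances of the
   tautologies written with the variables in 'p would be too few. *)

datatype schema = SVar nat | SNeg schema | SConj schema schema

primrec schema_eval :: "(nat \<Rightarrow> bool) \<Rightarrow> schema \<Rightarrow> bool" where
  "schema_eval v (SVar n) \<longleftrightarrow> v n"
| "schema_eval v (SNeg \<tau>) \<longleftrightarrow> \<not> schema_eval v \<tau>"
| "schema_eval v (SConj \<tau> \<tau>') \<longleftrightarrow> schema_eval v \<tau> \<and> schema_eval v \<tau>'"

primrec schema_inst :: "(nat \<Rightarrow> 'p fm) \<Rightarrow> schema \<Rightarrow> 'p fm" where
  "schema_inst \<sigma> (SVar n) = \<sigma> n"
| "schema_inst \<sigma> (SNeg \<tau>) = \<sim> (schema_inst \<sigma> \<tau>)"
| "schema_inst \<sigma> (SConj \<tau> \<tau>') = schema_inst \<sigma> \<tau> \<sqinter> schema_inst \<sigma> \<tau>'"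

definition tautology :: "schema \<Rightarrow> bool" where
  "tautology \<tau> \<longleftrightarrow> (\<forall>v. schema_eval v \<tau>)"

inductive_set ECZ :: "'p fm set" where
  TAUT: "tautology \<tau> \<Longrightarrow> schema_inst \<sigma> \<tau> \<in> ECZ"
| DEqu: "\<Delta> \<phi> \<rightleftharpoons> \<Delta> (\<sim> \<phi>) \<in> ECZ"
| DC: "\<Delta> \<phi> \<sqinter> \<Delta> \<psi> \<rightharpoonup> \<Delta> (\<phi> \<sqinter> \<psi>) \<in> ECZ"
| MP: "\<phi> \<in> ECZ \<Longrightarrow> \<phi> \<rightharpoonup> \<psi> \<in> ECZ \<Longrightarrow> \<psi> \<in> ECZ"
| RE: "\<phi> \<rightleftharpoons> \<psi> \<in> ECZ \<Longrightarrow> \<Delta> \<phi> \<rightleftharpoons> \<Delta> \<psi> \<in> ECZ"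

(* A system is represented by its set of theorems. The finite conjunctions
   have at least one conjunct, so the empty set is always consistent. *)

definition consistent :: "'p fm set \<Rightarrow> 'p fm set \<Rightarrow> bool" where
  "consistent \<Lambda> \<Gamma> \<longleftrightarrow>
     \<not> (\<exists>\<gamma> \<gamma>s. set (\<gamma> # \<gamma>s) \<subseteq> \<Gamma> \<and> \<sim> (foldl Conj \<gamma> \<gamma>s) \<in> \<Lambda>)"

(* HOL cannot quantify over the type of states inside a formula, so K is a class
   of frames whose carriers are subsets of one type 's. The property for some
   type 's implies the one for frames with arbitrary state sets. *)

definition strongly_complete :: "'p fm set \<Rightarrow> 's nframe set \<Rightarrow> bool" where
  "strongly_complete \<Lambda> K \<longleftrightarrow>
     (\<forall>\<Gamma>. consistent \<Lambda> \<Gamma> \<longrightarrow>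
        (\<exists>M :: ('s, 'p) nmodel. neighborhood_model M \<and> frame_of M \<in> K \<and>
           (\<exists>s\<in>states M. \<forall>\<phi>\<in>\<Gamma>. sat M s \<phi>)))"

end

theory Submission
  imports Defs
begin

text \<open>
  The model is canonical, and the point of the axioms is that nothing has to be repaired in it.
  A state is a maximal consistent set; the neighborhoods of \<open>s\<close> are the sets \<open>|\<phi>|\<close> of the states
  that contain \<open>\<phi>\<close>, for all \<open>\<phi>\<close> with \<open>\<Delta> \<phi> \<in> s\<close>. By the rule for equivalents, membership of \<open>|\<phi>|\<close>
  in this family depends on the set and not on the formula chosen to describe it
  (\<open>proof_set_in_canonical_nbhd\<close>). The schema \<open>\<Delta> \<phi> \<rightleftharpoons> \<Delta> (\<sim> \<phi>)\<close> makes the family closed under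
  complements, since \<open>|\<sim> \<phi>|\<close> is the complement of \<open>|\<phi>|\<close>, and also collapses the two disjuncts in the
  truth clause for \<open>\<Delta>\<close>; the schema \<open>\<Delta> \<phi> \<sqinter> \<Delta> \<psi> \<rightharpoonup> \<Delta> (\<phi> \<sqinter> \<psi>)\<close> makes it closed under intersections.
  Hence the frame has both properties and truth at a state is membership in it
  (\<open>truth_lemma\<close>).

  The propositional part is handled semantically. A truth assignment treats atoms and formulas
  \<open>\<Delta> \<phi>\<close> as independent prime constituents. The theorems are closed under tautological consequence from
  finitely many premises (\<open>ECZ_finite_consequence\<close>), so a set is consistent only if it is finitely
  satisfiable together with all theorems. Propositional compactness (\<open>compactness\<close>) then
  replaces the usual Lindenbaum construction, and a maximal consistent set is just the truth set
  of an assignment that verifies all theorems.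
\<close>

section \<open>Truth assignments and tautological consequence\<close>

definition truth_assignment :: "('p fm \<Rightarrow> bool) \<Rightarrow> bool" where
  "truth_assignment v \<longleftrightarrow>
     (\<forall>\<phi>. v (\<sim> \<phi>) \<longleftrightarrow> \<not> v \<phi>) \<and> (\<forall>\<phi> \<psi>. v (\<phi> \<sqinter> \<psi>) \<longleftrightarrow> v \<phi> \<and> v \<psi>)"

lemma truth_assignment_simps:
  assumes "truth_assignment v"
  shows "v (\<sim> \<phi>) \<longleftrightarrow> \<not> v \<phi>" and "v (\<phi> \<sqinter> \<psi>) \<longleftrightarrow> v \<phi> \<and> v \<psi>"
  using assms by (auto simp: truth_assignment_def)

lemma truth_assignment_foldl_Conj:
  assumes "truth_assignment v"
  shows "v (foldl Conj \<gamma> \<gamma>s) \<longleftrightarrow> v \<gamma> \<and> (\<forall>\<delta>\<in>set \<gamma>s. v \<delta>)"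
  by (induction \<gamma>s arbitrary: \<gamma>) (auto simp: truth_assignment_simps[OF assms])

primrec primes :: "'p fm \<Rightarrow> 'p fm set" where
  "primes (Atom p) = {Atom p}"
| "primes (\<sim> \<phi>) = primes \<phi>"
| "primes (\<phi> \<sqinter> \<psi>) = primes \<phi> \<union> primes \<psi>"
| "primes (\<Delta> \<phi>) = {\<Delta> \<phi>}"

lemma finite_primes: "finite (primes \<phi>)"
  by (induction \<phi>) auto

primrec schema_of :: "('p fm \<Rightarrow> nat) \<Rightarrow> 'p fm \<Rightarrow> schema" where
  "schema_of e (Atom p) = SVar (e (Atom p))"
| "schema_of e (\<sim> \<phi>) = SNeg (schema_of e \<phi>)"
| "schema_of e (\<phi> \<sqinter> \<psi>) = SConj (schema_of e \<phi>) (schema_of e \<psi>)"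
| "schema_of e (\<Delta> \<phi>) = SVar (e (\<Delta> \<phi>))"

lemma schema_inst_schema_of:
  assumes "\<And>\<pi>. \<pi> \<in> primes \<phi> \<Longrightarrow> \<sigma> (e \<pi>) = \<pi>"
  shows "schema_inst \<sigma> (schema_of e \<phi>) = \<phi>"
  using assms by (induction \<phi>) auto

text \<open>
  A formula has only finitely many prime constituents, so they can be numbered injectively; the
  numbering abstracts the formula to a schema of which it is an instance, and every valuation of the
  schema variables induces a truth assignment, so the schema is a tautology.
\<close>

lemma ECZ_if_true_under_all_assignments:
  assumes "\<And>v. truth_assignment v \<Longrightarrow> v \<phi>"
  shows "\<phi> \<in> ECZ"
proof -
  obtain e :: "'a fm \<Rightarrow> nat" where e: "inj_on e (primes \<phi>)"
    using finite_imp_inj_to_nat_seg[OF finite_primes] by blast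
  define \<sigma> where "\<sigma> = inv_into (primes \<phi>) e"
  have "schema_inst \<sigma> (schema_of e \<phi>) = \<phi>"
    by (rule schema_inst_schema_of) (simp add: \<sigma>_def e)
  moreover have "tautology (schema_of e \<phi>)"
    unfolding tautology_def
  proof
    fix v
    have "truth_assignment (\<lambda>\<psi>. schema_eval v (schema_of e \<psi>))"
      by (simp add: truth_assignment_def)
    then show "schema_eval v (schema_of e \<phi>)" by (rule assms)
  qed
  ultimately show ?thesis by (metis ECZ.TAUT)
qed

text \<open>
  Each premise is moved into the conclusion as the antecedent of an implication and discharged by
  modus ponens.
\<close>

lemma ECZ_finite_consequence:
  assumes "finite T" and "T \<subseteq> ECZ"
    and "\<And>v. truth_assignment v \<Longrightarrow> \<forall>\<tau>\<in>T. v \<tau> \<Longrightarrow> v \<phi>"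
  shows "\<phi> \<in> ECZ"
  using assms
proof (induction T arbitrary: \<phi> rule: finite_induct)
  case empty
  then show ?case by (auto intro: ECZ_if_true_under_all_assignments)
next
  case (insert \<tau> T)
  have "\<tau> \<rightharpoonup> \<phi> \<in> ECZ"
    using insert.prems by (intro insert.IH) (auto simp: truth_assignment_simps)
  then show ?case using insert.prems(1) by (auto intro: ECZ.MP)
qed

text \<open>
  Reading \<open>\<Delta>\<close> as constantly true verifies every axiom and is preserved by both rules. In
  particular the system does not prove every formula.
\<close>

lemma ECZ_true_under_some_assignment:
  obtains v where "truth_assignment v" and "\<forall>\<phi>\<in>ECZ. v \<phi>"
proof
  define v :: "'a fm \<Rightarrow> bool"
    where "v = rec_fm (\<lambda>_. True) (\<lambda>_ b. \<not> b) (\<lambda>_ _ b c. b \<and> c) (\<lambda>_ _. True)"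
  have v: "v (\<sim> \<phi>) \<longleftrightarrow> \<not> v \<phi>" "v (\<phi> \<sqinter> \<psi>) \<longleftrightarrow> v \<phi> \<and> v \<psi>" "v (\<Delta> \<phi>)" for \<phi> \<psi>
    by (simp_all add: v_def)
  show "truth_assignment v" by (simp add: truth_assignment_def v)
  show "\<forall>\<phi>\<in>ECZ. v \<phi>"
  proof
    fix \<phi> :: "'a fm"
    assume "\<phi> \<in> ECZ"
    then show "v \<phi>"
    proof induction
      case (TAUT \<tau> \<sigma>)
      have "v (schema_inst \<sigma> \<tau>) = schema_eval (\<lambda>n. v (\<sigma> n)) \<tau>"
        by (induction \<tau>) (simp_all add: v)
      then show ?case using TAUT by (simp add: tautology_def)
    qed (auto simp: v)
  qed
qed

section \<open>Propositional compactness\<close>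

definition finitely_satisfiable :: "'p fm set \<Rightarrow> bool" where
  "finitely_satisfiable S \<longleftrightarrow>
     (\<forall>F. finite F \<and> F \<subseteq> S \<longrightarrow> (\<exists>v. truth_assignment v \<and> (\<forall>\<phi>\<in>F. v \<phi>)))"

lemma finitely_satisfiableE:
  assumes "finitely_satisfiable S" and "finite F" and "F \<subseteq> S"
  obtains v where "truth_assignment v" and "\<forall>\<phi>\<in>F. v \<phi>"
  using assms by (auto simp: finitely_satisfiable_def)

lemma finitely_satisfiable_Union_chain:
  assumes "subset.chain {S. finitely_satisfiable S} C" and "C \<noteq> {}"
  shows "finitely_satisfiable (\<Union>C)"
  unfolding finitely_satisfiable_def
proof (intro allI impI, elim conjE)
  fix F assume F: "finite F" "F \<subseteq> \<Union>C"
  obtain S where "S \<in> C" "F \<subseteq> S"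
    using finite_subset_Union_chain[OF F assms(2,1)] by blast
  with F(1) assms(1) show "\<exists>v. truth_assignment v \<and> (\<forall>\<phi>\<in>F. v \<phi>)"
    by (auto simp: finitely_satisfiable_def subset.chain_def)
qed

lemma finitely_satisfiable_insert_or_insert_Neg:
  assumes "finitely_satisfiable S"
  shows "finitely_satisfiable (insert \<phi> S) \<or> finitely_satisfiable (insert (\<sim> \<phi>) S)"
proof (rule ccontr)
  assume "\<not> ?thesis"
  then have "\<not> finitely_satisfiable (insert \<phi> S)"
    and "\<not> finitely_satisfiable (insert (\<sim> \<phi>) S)" by simp_all
  obtain F where F: "finite F" "F \<subseteq> insert \<phi> S"
    "\<And>v. truth_assignment v \<Longrightarrow> \<not> (\<forall>\<psi>\<in>F. v \<psi>)"
    using \<open>\<not> finitely_satisfiable (insert \<phi> S)\<close> by (auto simp: finitely_satisfiable_def)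
  obtain G where G: "finite G" "G \<subseteq> insert (\<sim> \<phi>) S"
    "\<And>v. truth_assignment v \<Longrightarrow> \<not> (\<forall>\<psi>\<in>G. v \<psi>)"
    using \<open>\<not> finitely_satisfiable (insert (\<sim> \<phi>) S)\<close> by (auto simp: finitely_satisfiable_def)
  have "finite ((F - {\<phi>}) \<union> (G - {\<sim> \<phi>}))" "(F - {\<phi>}) \<union> (G - {\<sim> \<phi>}) \<subseteq> S"
    using F(1,2) G(1,2) by auto
  then obtain v where v: "truth_assignment v" "\<forall>\<psi>\<in>(F - {\<phi>}) \<union> (G - {\<sim> \<phi>}). v \<psi>"
    by (rule finitely_satisfiableE[OF assms])
  have "(\<forall>\<psi>\<in>F. v \<psi>) \<or> (\<forall>\<psi>\<in>G. v \<psi>)"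
  proof (cases "v \<phi>")
    case True
    then show ?thesis using v(2) by auto
  next
    case False
    then have "v (\<sim> \<phi>)" using v(1) by (simp add: truth_assignment_simps)
    then have "v \<psi>" if "\<psi> \<in> G" for \<psi>
      using v(2) that by (cases "\<psi> = \<sim> \<phi>") simp_all
    then show ?thesis by simp
  qed
  then show False using F(3)[OF v(1)] G(3)[OF v(1)] by simp
qed

text \<open>
  A maximal finitely satisfiable set decides every formula, and no finite part of it is
  contradictory; so its membership predicate is itself a truth assignment.
\<close>

lemma compactness:
  assumes "finitely_satisfiable S"
  obtains M where "S \<subseteq> M" and "truth_assignment (\<lambda>\<phi>. \<phi> \<in> M)"
proof -
  let ?A = "{M. S \<subseteq> M \<and> finitely_satisfiable M}"
  have "\<exists>M\<in>?A. \<forall>X\<in>?A. M \<subseteq> X \<longrightarrow> X = M"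
  proof (rule subset_Zorn_nonempty)
    show "?A \<noteq> {}" using assms by blast
    fix C assume C: "C \<noteq> {}" "subset.chain ?A C"
    then have "subset.chain {M. finitely_satisfiable M} C"
      by (auto simp: subset.chain_def)
    then have "finitely_satisfiable (\<Union>C)"
      using C(1) by (rule finitely_satisfiable_Union_chain)
    then show "\<Union>C \<in> ?A" using C unfolding subset.chain_def by blast
  qed
  then obtain M where M: "S \<subseteq> M" "finitely_satisfiable M"
    and max: "\<And>X. S \<subseteq> X \<Longrightarrow> finitely_satisfiable X \<Longrightarrow> M \<subseteq> X \<Longrightarrow> X = M"
    unfolding bex_simps ball_simps mem_Collect_eq by metis
  have decides: "\<phi> \<in> M \<or> \<sim> \<phi> \<in> M" for \<phi>
    using finitely_satisfiable_insert_or_insert_Neg[OF M(2), of \<phi>]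
      max[of "insert \<phi> M"] max[of "insert (\<sim> \<phi>) M"] M(1) by blast
  have sat: "\<exists>v. truth_assignment v \<and> (\<forall>\<phi>\<in>F. v \<phi>)" if "finite F" "F \<subseteq> M" for F
    using finitely_satisfiableE[OF M(2) that] by metis
  have neg: "\<sim> \<phi> \<in> M \<longleftrightarrow> \<phi> \<notin> M" for \<phi>
    using sat[of "{\<phi>, \<sim> \<phi>}"] decides[of \<phi>] by (auto simp: truth_assignment_simps)
  have conj: "\<phi> \<sqinter> \<psi> \<in> M \<longleftrightarrow> \<phi> \<in> M \<and> \<psi> \<in> M" for \<phi> \<psi>
    using sat[of "{\<phi> \<sqinter> \<psi>, \<sim> \<phi>}"] sat[of "{\<phi> \<sqinter> \<psi>, \<sim> \<psi>}"] sat[of "{\<phi>, \<psi>, \<sim> (\<phi> \<sqinter> \<psi>)}"]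
    by (auto simp: truth_assignment_simps neg cong: conj_cong)
  show ?thesis
    using that M(1) neg conj by (auto simp: truth_assignment_def)
qed

section \<open>Maximal consistent sets\<close>

definition canonical_states :: "'p fm set set" where
  "canonical_states = {s. truth_assignment (\<lambda>\<phi>. \<phi> \<in> s) \<and> ECZ \<subseteq> s}"

lemma canonical_state_simps:
  assumes "s \<in> canonical_states"
  shows "\<sim> \<phi> \<in> s \<longleftrightarrow> \<phi> \<notin> s" and "\<phi> \<sqinter> \<psi> \<in> s \<longleftrightarrow> \<phi> \<in> s \<and> \<psi> \<in> s"
  using assms by (auto simp: canonical_states_def truth_assignment_def)

lemma ECZ_in_canonical_state:
  assumes "\<phi> \<in> ECZ" and "s \<in> canonical_states"
  shows "\<phi> \<in> s"
  using assms by (auto simp: canonical_states_def)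

text \<open>
  If a finite set of members of \<open>\<Gamma>\<close> and theorems had no satisfying assignment, then the
  negated conjunction of those members of \<open>\<Gamma>\<close> would follow tautologically from the theorems.
\<close>

lemma consistent_imp_finitely_satisfiable:
  assumes "consistent ECZ \<Gamma>"
  shows "finitely_satisfiable (\<Gamma> \<union> ECZ)"
  unfolding finitely_satisfiable_def
proof (intro allI impI, elim conjE)
  fix F assume F: "finite F" "F \<subseteq> \<Gamma> \<union> ECZ"
  obtain \<gamma>s where \<gamma>s: "set \<gamma>s = F \<inter> \<Gamma>"
    using F(1) finite_list[of "F \<inter> \<Gamma>"] by blast
  show "\<exists>v. truth_assignment v \<and> (\<forall>\<phi>\<in>F. v \<phi>)"
  proof (cases \<gamma>s)
    case Nil
    \<comment> \<open>Consistency says nothing about the empty list, so the consistency of the system itself is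
      used here.\<close>
    then have "F \<subseteq> ECZ" using F(2) \<gamma>s by auto
    moreover obtain v :: "'a fm \<Rightarrow> bool" where "truth_assignment v" "\<forall>\<phi>\<in>ECZ. v \<phi>"
      by (rule ECZ_true_under_some_assignment)
    ultimately show ?thesis by blast
  next
    case (Cons \<gamma> \<delta>s)
    have "\<sim> (foldl Conj \<gamma> \<delta>s) \<notin> ECZ"
      using assms \<gamma>s Cons unfolding consistent_def by (metis Int_lower2)
    then obtain v where v: "truth_assignment v" "\<forall>\<tau>\<in>F \<inter> ECZ. v \<tau>"
      "\<not> v (\<sim> (foldl Conj \<gamma> \<delta>s))"
      using ECZ_finite_consequence[of "F \<inter> ECZ" "\<sim> (foldl Conj \<gamma> \<delta>s)"] F(1) by blast
    then have "\<forall>\<delta>\<in>F \<inter> \<Gamma>. v \<delta>"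
      using Cons \<gamma>s[symmetric] by (auto simp: truth_assignment_simps truth_assignment_foldl_Conj)
    then show ?thesis using v F(2) by blast
  qed
qed

lemma consistent_subset_canonical_state:
  assumes "consistent ECZ \<Gamma>"
  obtains s where "s \<in> canonical_states" and "\<Gamma> \<subseteq> s"
proof -
  obtain s where "\<Gamma> \<union> ECZ \<subseteq> s" and "truth_assignment (\<lambda>\<phi>. \<phi> \<in> s)"
    by (rule compactness[OF consistent_imp_finitely_satisfiable[OF assms]])
  then show ?thesis using that[of s] by (simp add: canonical_states_def)
qed

text \<open>
  A formula that is not a theorem has a consistent negation: the inconsistency of \<open>{\<sim> \<phi>}\<close> is
  witnessed by a theorem \<open>\<sim> (\<sim> \<phi> \<sqinter> \<dots> \<sqinter> \<sim> \<phi>)\<close>, which is tautologically equivalent to \<open>\<phi>\<close>.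
\<close>

lemma ECZ_if_in_all_canonical_states:
  assumes "\<And>s. s \<in> canonical_states \<Longrightarrow> \<phi> \<in> s"
  shows "\<phi> \<in> ECZ"
proof -
  have "\<not> consistent ECZ {\<sim> \<phi>}"
  proof
    assume "consistent ECZ {\<sim> \<phi>}"
    then obtain s where "s \<in> canonical_states" "{\<sim> \<phi>} \<subseteq> s"
      by (rule consistent_subset_canonical_state)
    then show False using assms by (auto simp: canonical_state_simps)
  qed
  then obtain \<gamma> \<gamma>s where \<gamma>s: "set (\<gamma> # \<gamma>s) \<subseteq> {\<sim> \<phi>}" "\<sim> (foldl Conj \<gamma> \<gamma>s) \<in> ECZ"
    unfolding consistent_def by blast
  show ?thesis
  proof (rule ECZ_finite_consequence[of "{\<sim> (foldl Conj \<gamma> \<gamma>s)}"])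
    fix v :: "'a fm \<Rightarrow> bool"
    assume "truth_assignment v" "\<forall>\<tau>\<in>{\<sim> (foldl Conj \<gamma> \<gamma>s)}. v \<tau>"
    then show "v \<phi>"
      using \<gamma>s(1) by (auto simp: truth_assignment_simps truth_assignment_foldl_Conj)
  qed (use \<gamma>s(2) in auto)
qed

section \<open>The canonical model\<close>

definition proof_set :: "'p fm \<Rightarrow> 'p fm set set" where
  "proof_set \<phi> = {s \<in> canonical_states. \<phi> \<in> s}"

lemma proof_set_Neg: "proof_set (\<sim> \<phi>) = canonical_states - proof_set \<phi>"
  by (auto simp: proof_set_def canonical_state_simps)

lemma proof_set_Conj: "proof_set (\<phi> \<sqinter> \<psi>) = proof_set \<phi> \<inter> proof_set \<psi>"
  by (auto simp: proof_set_def canonical_state_simps)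

definition canonical_model :: "('p fm set, 'p) nmodel" where
  "canonical_model = \<lparr>states = canonical_states,
     nbhd = (\<lambda>s. {proof_set \<phi> |\<phi>. \<Delta> \<phi> \<in> s}), val = (\<lambda>p. proof_set (Atom p))\<rparr>"

lemma canonical_model_simps [simp]:
  "states canonical_model = canonical_states"
  "nbhd canonical_model s = {proof_set \<phi> |\<phi>. \<Delta> \<phi> \<in> s}"
  "val canonical_model p = proof_set (Atom p)"
  by (simp_all add: canonical_model_def)

lemma frame_of_simps [simp]:
  "states (frame_of M) = states M" "nbhd (frame_of M) = nbhd M"
  by (simp_all add: frame_of_def nframe.truncate_def)

text \<open>
  Formulas with the same proof set are provably equivalent, so the rule for equivalents transfers
  \<open>\<Delta>\<close> from one to the other.
\<close>

lemma proof_set_in_canonical_nbhd: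
  assumes s: "s \<in> canonical_states"
  shows "proof_set \<phi> \<in> nbhd canonical_model s \<longleftrightarrow> \<Delta> \<phi> \<in> s"
proof
  assume "proof_set \<phi> \<in> nbhd canonical_model s"
  then obtain \<psi> where \<psi>: "proof_set \<phi> = proof_set \<psi>" "\<Delta> \<psi> \<in> s" by auto
  have "\<phi> \<rightleftharpoons> \<psi> \<in> ECZ"
  proof (rule ECZ_if_in_all_canonical_states)
    fix t :: "'a fm set"
    assume "t \<in> canonical_states"
    then show "\<phi> \<rightleftharpoons> \<psi> \<in> t"
      using \<psi>(1) by (auto simp: proof_set_def canonical_state_simps)
  qed
  then have "\<Delta> \<phi> \<rightleftharpoons> \<Delta> \<psi> \<in> s" using ECZ.RE ECZ_in_canonical_state[OF _ s] by blast
  then show "\<Delta> \<phi> \<in> s" using \<psi>(2) s by (simp add: canonical_state_simps)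
qed auto

lemma Dlt_Neg_in_canonical_state:
  assumes "s \<in> canonical_states"
  shows "\<Delta> (\<sim> \<phi>) \<in> s \<longleftrightarrow> \<Delta> \<phi> \<in> s"
  using ECZ_in_canonical_state[OF ECZ.DEqu assms, of \<phi>] assms by (auto simp: canonical_state_simps)

lemma Dlt_Conj_in_canonical_state:
  assumes "s \<in> canonical_states" and "\<Delta> \<phi> \<in> s" and "\<Delta> \<psi> \<in> s"
  shows "\<Delta> (\<phi> \<sqinter> \<psi>) \<in> s"
  using ECZ_in_canonical_state[OF ECZ.DC assms(1), of \<phi> \<psi>] assms
  by (auto simp: canonical_state_simps)

lemma truth_lemma:
  assumes "s \<in> canonical_states"
  shows "sat canonical_model s \<phi> \<longleftrightarrow> \<phi> \<in> s"
  using assms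
proof (induction \<phi> arbitrary: s)
  case (Dlt \<phi>)
  have "{t \<in> states canonical_model. sat canonical_model t \<phi>} = proof_set \<phi>"
    using Dlt.IH by (auto simp: proof_set_def)
  then have "sat canonical_model s (\<Delta> \<phi>) \<longleftrightarrow>
      proof_set \<phi> \<in> nbhd canonical_model s \<or> proof_set (\<sim> \<phi>) \<in> nbhd canonical_model s"
    by (simp add: proof_set_Neg del: canonical_model_simps(2))
  then show ?case
    using Dlt.prems
    by (simp add: proof_set_in_canonical_nbhd Dlt_Neg_in_canonical_state
        del: canonical_model_simps(2))
qed (auto simp: canonical_state_simps proof_set_def)

lemma property_c_canonical: "property_c (frame_of canonical_model)"
  unfolding property_c_def
proof (intro ballI allI impI, elim conjE)
  fix s X Y
  assume "s \<in> states (frame_of (canonical_model :: ('a fm set, 'a) nmodel))"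
    and "X \<in> nbhd (frame_of canonical_model) s" and "Y \<in> nbhd (frame_of canonical_model) s"
  then obtain \<phi> \<psi> where "s \<in> canonical_states"
    "X = proof_set \<phi>" "\<Delta> \<phi> \<in> s" "Y = proof_set \<psi>" "\<Delta> \<psi> \<in> s" by auto
  then show "X \<inter> Y \<in> nbhd (frame_of canonical_model) s"
    using Dlt_Conj_in_canonical_state[of s \<phi> \<psi>] proof_set_Conj[of \<phi> \<psi>] by auto
qed

lemma property_z_canonical: "property_z (frame_of canonical_model)"
  unfolding property_z_def
proof (intro ballI allI impI)
  fix s X
  assume "s \<in> states (frame_of (canonical_model :: ('a fm set, 'a) nmodel))"
    and "X \<in> nbhd (frame_of canonical_model) s"
  then obtain \<phi> where "s \<in> canonical_states" "X = proof_set \<phi>" "\<Delta> \<phi> \<in> s" by auto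
  then show "states (frame_of canonical_model) - X \<in> nbhd (frame_of canonical_model) s"
    using Dlt_Neg_in_canonical_state[of s \<phi>] proof_set_Neg[of \<phi>] by auto
qed

lemma neighborhood_frame_canonical: "neighborhood_frame (frame_of canonical_model)"
proof -
  have "consistent ECZ {}" by (simp add: consistent_def)
  then obtain s :: "'a fm set" where "s \<in> canonical_states"
    by (rule consistent_subset_canonical_state)
  then show ?thesis by (auto simp: neighborhood_frame_def proof_set_def)
qed

theorem theorem7:
  shows "strongly_complete (ECZ :: 'p fm set) (cz_frames :: 'p fm set nframe set)"
  unfolding strongly_complete_def
proof (intro allI impI)
  fix \<Gamma> :: "'p fm set"
  assume "consistent ECZ \<Gamma>"
  then obtain s where s: "s \<in> canonical_states" "\<Gamma> \<subseteq> s"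
    by (rule consistent_subset_canonical_state)
  have "neighborhood_model (canonical_model :: ('p fm set, 'p) nmodel)"
    using neighborhood_frame_canonical by (auto simp: neighborhood_model_def proof_set_def)
  moreover have "frame_of (canonical_model :: ('p fm set, 'p) nmodel) \<in> cz_frames"
    by (simp add: cz_frames_def neighborhood_frame_canonical property_c_canonical
        property_z_canonical)
  moreover have "\<forall>\<phi>\<in>\<Gamma>. sat canonical_model s \<phi>"
    using s by (auto simp: truth_lemma)
  ultimately show "\<exists>M :: ('p fm set, 'p) nmodel. neighborhood_model M \<and> frame_of M \<in> cz_frames \<and>
      (\<exists>s\<in>states M. \<forall>\<phi>\<in>\<Gamma>. sat M s \<phi>)"
    using s(1) by (intro exI[of _ canonical_model]) auto
qed

end
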